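(* Let $S:\mathbb{R}\rightrightarrows\mathbb{R}^{n}$ be a smooth sweeping process, let $t\in\mathrm{dom}(S)$ with $t\neq\sup(\mathrm{dom}(S))$, and let $x\in S(t)$ be such that $\Vert D^{\ast}S(t,x)|^{+}<+\infty$. Then $$\mathrm{calm}^{\uparrow}S(t,x)=\Vert D^{\ast}S(t,x)|^{+}.$$
   Context: For a multivalued map $S:\mathbb{R}\rightrightarrows\mathbb{R}^n$: $\mathrm{dom}(S)=\{t:S(t)\ne\emptyset\}$, and $\mathcal{S}=\mathrm{gph}(S)=\{(t,x)\in\mathbb{R}^{n+1}:x\in S(t)\}$; $\partial\mathcal{S}$ is the boundary of $\mathcal{S}$ in $\mathbb{R}^{n+1}$. Smooth sweeping process: $S$ has closed graph $\mathcal{S}$ and either (1) $\mathcal{S}$ is a closed connected $\mathcal{C}^1$-smooth submanifold of $\mathbb{R}^{n+1}$ of dimension at most $n$; or (2) $\mathcal{S}$ is a connected smooth manifold of full dimension $n+1$ with boundary, and $\partial\mathcal{S}$ is a $\mathcal{C}^1$-smooth manifold of dimension $n$. Normal cones: for a closed set $C\subset\mathbb{R}^m$ and $x\in C$, the Fréchet normal cone $\hat N_C(x)$ is the set of $v$ with $\limsup_{y\to x,\,y\in C}\langle v,y-x\rangle/\Vert y-x\Vert\le 0$; the limiting normal cone $N_C(x)$ is the set of limits $v=\lim v_i$ with $v_i\in\hat N_C(x_i)$, $x_i\in C$, $x_i\to x$. Coderivative: $D^{\ast}S(t,x)(u)=\{\alpha\in\mathbb{R}:(\alpha,-u)\in N_{\mathcal{S}}(t,x)\}$.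 Asymmetric modulus: $\Vert D^{\ast}S(t,x)|^{+}=\sup\{\alpha^{+}:\alpha\in D^{\ast}S(t,x)(u),\ \Vert u\Vert\le 1\}$, where $\alpha^+=\max\{0,\alpha\}$ and $\sup\emptyset=0$. Oriented calm graphical modulus: with $B$ the open unit ball of $\mathbb{R}^n$ and $B(x,\delta)$ the open ball of radius $\delta$ centred at $x$, $$\mathrm{calm}^{\uparrow}S(t,x)=\inf\{\kappa>0:\ \exists\,\epsilon>0,\ \delta>0\text{ such that }S(t)\cap B(x,\delta)\subset S(t_1)+\kappa|t_1-t|B\ \text{ for all }t_1\in(t,t+\epsilon)\}.$$ *)

theory Defs
  imports "HOL-Analysis.Analysis"
begin

subsection \<open>Multivalued maps\<close>

definition mdom :: "(real \<Rightarrow> 'a set) \<Rightarrow> real set" where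
  "mdom S = {t. S t \<noteq> {}}"

definition gph :: "(real \<Rightarrow> 'a set) \<Rightarrow> (real \<times> 'a) set" where
  "gph S = {(t, x). x \<in> S t}"

subsection \<open>Continuously differentiable submanifolds\<close>

definition C1_on :: "'a::real_normed_vector set \<Rightarrow> ('a \<Rightarrow> 'b::real_normed_vector) \<Rightarrow> bool" where
  "C1_on U f \<longleftrightarrow>
     (\<exists>f' :: 'a \<Rightarrow> 'a \<Rightarrow>\<^sub>L 'b.
        (\<forall>x\<in>U. (f has_derivative blinfun_apply (f' x)) (at x)) \<and> continuous_on U f')"

definition C1_diffeomorphism ::
  "'a::real_normed_vector set \<Rightarrow> 'b::real_normed_vector set \<Rightarrow> ('a \<Rightarrow> 'b) \<Rightarrow> ('b \<Rightarrow> 'a) \<Rightarrow> bool" where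
  "C1_diffeomorphism U V f g \<longleftrightarrow>
     open U \<and> open V \<and> homeomorphism U V f g \<and> C1_on U f \<and> C1_on V g"

text \<open>Embedded submanifolds, without boundary, given by charts of the ambient space that
  flatten the set to a linear subspace of dimension \<open>k\<close>. The empty set qualifies for every \<open>k\<close>.\<close>

definition C1_submanifold :: "nat \<Rightarrow> 'a::euclidean_space set \<Rightarrow> bool" where
  "C1_submanifold k M \<longleftrightarrow>
     (\<forall>p\<in>M. \<exists>U V f g L. p \<in> U \<and> C1_diffeomorphism U V f (g :: 'a \<Rightarrow> 'a) \<and>
        subspace L \<and> dim L = k \<and> f ` (U \<inter> M) = V \<inter> L)"

text \<open>Manifolds with boundary of the same dimension as the ambient space: the charts carry the
  set to a relatively open part of a closed half-space. An interior point has a chart whose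
  image \<open>V\<close> lies in the open half-space, so the manifold boundary may be empty.\<close>

definition full_dim_C1_manifold_with_boundary :: "'a::euclidean_space set \<Rightarrow> bool" where
  "full_dim_C1_manifold_with_boundary M \<longleftrightarrow>
     (\<forall>p\<in>M. \<exists>U V f g. \<exists>b\<in>Basis. p \<in> U \<and> C1_diffeomorphism U V f (g :: 'a \<Rightarrow> 'a) \<and>
        f ` (U \<inter> M) = V \<inter> {y. 0 \<le> b \<bullet> y})"

definition smooth_sweeping_process :: "(real \<Rightarrow> (real ^ 'n) set) \<Rightarrow> bool" where
  "smooth_sweeping_process S \<longleftrightarrow>
     closed (gph S) \<and>
     ((connected (gph S) \<and> (\<exists>k \<le> CARD('n). C1_submanifold k (gph S))) \<or>
      (connected (gph S) \<and> full_dim_C1_manifold_with_boundary (gph S) \<and>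
       C1_submanifold CARD('n) (frontier (gph S))))"

subsection \<open>Normal cones and the coderivative\<close>

text \<open>At an isolated point of \<open>C\<close> the filter is trivial, the upper limit is \<open>-\<infinity>\<close>, and the
  Frechet normal cone is the whole space.\<close>

definition frechet_normal_cone :: "'a::euclidean_space set \<Rightarrow> 'a \<Rightarrow> 'a set" where
  "frechet_normal_cone C x =
     {v. Limsup (at x within C) (\<lambda>y. ereal (v \<bullet> (y - x) / norm (y - x))) \<le> 0}"

definition limiting_normal_cone :: "'a::euclidean_space set \<Rightarrow> 'a \<Rightarrow> 'a set" where
  "limiting_normal_cone C x =
     {v. \<exists>xs vs. (\<forall>i::nat. xs i \<in> C \<and> vs i \<in> frechet_normal_cone C (xs i)) \<and>
           xs \<longlonglongrightarrow> x \<and> vs \<longlonglongrightarrow> v}"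

definition coderivative ::
  "(real \<Rightarrow> 'a::euclidean_space set) \<Rightarrow> real \<Rightarrow> 'a \<Rightarrow> 'a \<Rightarrow> real set" where
  "coderivative S t x u = {\<alpha>. (\<alpha>, - u) \<in> limiting_normal_cone (gph S) (t, x)}"

text \<open>Both moduli take values in \<open>[0, \<infinity>]\<close>, so that a supremum over the empty set is \<open>0\<close> and
  an infimum over the empty set is \<open>\<infinity>\<close>.\<close>

definition asym_modulus :: "(real \<Rightarrow> 'a::euclidean_space set) \<Rightarrow> real \<Rightarrow> 'a \<Rightarrow> ennreal" where
  "asym_modulus S t x =
     Sup {ennreal (max 0 \<alpha>) | \<alpha> u. \<alpha> \<in> coderivative S t x u \<and> norm u \<le> 1}"

definition calm_up :: "(real \<Rightarrow> 'a::euclidean_space set) \<Rightarrow> real \<Rightarrow> 'a \<Rightarrow> ennreal" where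
  "calm_up S t x =
     Inf {ennreal \<kappa> | \<kappa>. \<kappa> > 0 \<and>
       (\<exists>\<epsilon>>0. \<exists>\<delta>>0. \<forall>t1\<in>{t<..<t + \<epsilon>}.
          S t \<inter> ball x \<delta> \<subseteq> {y + (\<kappa> * \<bar>t1 - t\<bar>) *\<^sub>R b | y b. y \<in> S t1 \<and> b \<in> ball 0 1})}"

end

theory Submission
  imports Defs
begin

text \<open>
  In both cases of a smooth sweeping process the graph is locally the image of a convex set \<open>K\<close>
  (a subspace or a half-space) under a \<open>C\<^sup>1\<close> diffeomorphism \<open>g\<close>. Hence the limiting normal cone
  at \<open>p = (t, x)\<close> equals the Frechet one, and both are the polar of \<open>g' (K - y)\<close>, where
  \<open>g y = p\<close>. Testing a Frechet normal along the points which the definition of \<open>calm_up\<close> provides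
  at times just after \<open>t\<close> yields \<open>asym_modulus \<le> calm_up\<close>.

  Conversely, let \<open>\<kappa>\<close> exceed the modulus. A hyperplane separating \<open>g' (K - y)\<close> from the cone
  \<open>{(s, w). norm w < \<kappa> * s}\<close> would have a normal in the normal cone that contradicts this, so some
  \<open>g' (z - y)\<close> with \<open>z \<in> K\<close> lies in that cone. By convexity of \<open>K\<close> and strict differentiability of
  \<open>g\<close>, the paths \<open>g (\<eta> + \<theta> * (z - \<eta>))\<close> stay in the graph and move with speed below \<open>\<kappa>\<close>
  relative to time, uniformly for \<open>\<eta> \<in> K\<close> near \<open>y\<close>; this yields \<open>calm_up \<le> \<kappa>\<close>.
\<close>

section \<open>Frechet and limiting normal cones\<close>

text \<open>The product form holds trivially at \<open>y = x\<close>, so it needs no quotient and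
  covers isolated points.\<close>

lemma frechet_normal_cone_iff:
  "v \<in> frechet_normal_cone C x \<longleftrightarrow>
     (\<forall>e>0. \<exists>d>0. \<forall>y\<in>C. dist y x < d \<longrightarrow> v \<bullet> (y - x) \<le> e * norm (y - x))"
proof -
  have "v \<in> frechet_normal_cone C x \<longleftrightarrow>
      (\<forall>c>0. eventually (\<lambda>y. ereal (v \<bullet> (y - x) / norm (y - x)) < c) (at x within C))"
    unfolding frechet_normal_cone_def mem_Collect_eq Limsup_le_iff by (rule refl)
  also have "\<dots> \<longleftrightarrow> (\<forall>e>0. eventually (\<lambda>y. v \<bullet> (y - x) / norm (y - x) < e) (at x within C))"
    (is "?L \<longleftrightarrow> ?R")
  proof
    assume L: ?L
    show ?R
    proof (intro allI impI)
      fix e :: real assume "e > 0"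
      with L[rule_format, of "ereal e"]
      show "eventually (\<lambda>y. v \<bullet> (y - x) / norm (y - x) < e) (at x within C)" by simp
    qed
  next
    assume R: ?R
    show ?L
    proof (intro allI impI)
      fix c :: ereal assume "c > 0"
      then obtain e where "0 < ereal e" "ereal e < c"
        using ereal_dense2 by blast
      with R have "eventually (\<lambda>y. v \<bullet> (y - x) / norm (y - x) < e) (at x within C)"
        by simp
      then show "eventually (\<lambda>y. ereal (v \<bullet> (y - x) / norm (y - x)) < c) (at x within C)"
      proof eventually_elim
        case (elim y)
        then have "ereal (v \<bullet> (y - x) / norm (y - x)) < ereal e" by simp
        then show ?case using \<open>ereal e < c\<close> by (rule less_trans)
      qed
    qed
  qed
  also have "\<dots> \<longleftrightarrow> (\<forall>e>0. \<exists>d>0. \<forall>y\<in>C. dist y x < d \<longrightarrow> v \<bullet> (y - x) \<le> e * norm (y - x))"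
    (is "_ \<longleftrightarrow> ?F")
  proof
    assume R: ?R
    show ?F
    proof (intro allI impI)
      fix e :: real assume "e > 0"
      with R obtain d where "d > 0"
        and d: "\<And>y. y \<in> C \<Longrightarrow> y \<noteq> x \<Longrightarrow> dist y x < d \<Longrightarrow> v \<bullet> (y - x) / norm (y - x) < e"
        unfolding eventually_at by metis
      have "v \<bullet> (y - x) \<le> e * norm (y - x)" if "y \<in> C" "dist y x < d" for y
        using d[OF that(1) _ that(2)] by (cases "y = x") (auto simp: field_simps)
      with \<open>d > 0\<close> show "\<exists>d>0. \<forall>y\<in>C. dist y x < d \<longrightarrow> v \<bullet> (y - x) \<le> e * norm (y - x)"
        by blast
    qed
  next
    assume F: ?F
    show ?R
    proof (intro allI impI)
      fix e :: real assume "e > 0"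
      \<comment> \<open>\<open>?F\<close> gives a weak inequality; half of \<open>e\<close> makes it
        strict.\<close>
      then have "e / 2 > 0" by simp
      with F obtain d where "d > 0"
        and d: "\<And>y. y \<in> C \<Longrightarrow> dist y x < d \<Longrightarrow> v \<bullet> (y - x) \<le> e / 2 * norm (y - x)"
        by meson
      have "v \<bullet> (y - x) / norm (y - x) < e" if "y \<in> C" "y \<noteq> x" "dist y x < d" for y
      proof -
        have "v \<bullet> (y - x) / norm (y - x) \<le> e / 2"
          using d[OF that(1,3)] that(2) by (simp add: divide_simps)
        also have "\<dots> < e" using \<open>e > 0\<close> by simp
        finally show ?thesis .
      qed
      with \<open>d > 0\<close> show "eventually (\<lambda>y. v \<bullet> (y - x) / norm (y - x) < e) (at x within C)"
        unfolding eventually_at by blast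
    qed
  qed
  finally show ?thesis .
qed

lemma frechet_subset_limiting:
  assumes "x \<in> C"
  shows "frechet_normal_cone C x \<subseteq> limiting_normal_cone C x"
proof
  fix v assume "v \<in> frechet_normal_cone C x"
  with assms show "v \<in> limiting_normal_cone C x"
    unfolding limiting_normal_cone_def
    by (intro CollectI exI[of _ "\<lambda>_. x"] exI[of _ "\<lambda>_. v"]) auto
qed

section \<open>Lower bound for calmness from Frechet normals\<close>

text \<open>Calmness yields a graph point displaced by \<open>\<tau>\<close> in time and by at most
  \<open>\<kappa> * \<tau>\<close> in space. The normal pairs with this displacement to at least
  \<open>(\<alpha> - \<kappa>) * \<tau>\<close>, while Frechet normality bounds the pairing above by
  o(\<open>\<tau>\<close>).\<close>

lemma calm_up_ge_frechet:
  assumes v: "(\<alpha>, - u) \<in> frechet_normal_cone (gph S) (t, x)" and "norm u \<le> 1" "x \<in> S t"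
  shows "ennreal (max 0 \<alpha>) \<le> calm_up S t x"
  unfolding calm_up_def
proof (rule Inf_greatest, clarify)
  fix \<kappa> \<epsilon> \<delta> :: real
  assume "\<kappa> > 0" "\<epsilon> > 0" "\<delta> > 0"
    and sub: "\<forall>t1\<in>{t<..<t + \<epsilon>}. S t \<inter> ball x \<delta> \<subseteq> {y + (\<kappa> * \<bar>t1 - t\<bar>) *\<^sub>R b | y b. y \<in> S t1 \<and> b \<in> ball 0 1}"
  have "\<alpha> \<le> \<kappa> + e" if "e > 0" for e
  proof -
    \<comment> \<open>The displacement tested below has norm at most
      \<open>\<tau> * (1 + \<kappa>)\<close>, so this scaling turns the error into
      \<open>e * \<tau>\<close>.\<close>
    define e' where "e' = e / (1 + \<kappa>)"
    have "e' > 0" using that \<open>\<kappa> > 0\<close> by (simp add: e'_def)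
    then obtain d where "d > 0" and d: "\<And>y. y \<in> gph S \<Longrightarrow> dist y (t, x) < d \<Longrightarrow>
        (\<alpha>, - u) \<bullet> (y - (t, x)) \<le> e' * norm (y - (t, x))"
      using v unfolding frechet_normal_cone_iff by meson
    have "d / (1 + \<kappa>) > 0" using \<open>d > 0\<close> \<open>\<kappa> > 0\<close> by simp
    then obtain \<tau> where \<tau>: "\<tau> > 0" "\<tau> < \<epsilon>" and "\<tau> < d / (1 + \<kappa>)"
      using \<open>\<epsilon> > 0\<close> dense[of 0 "min \<epsilon> (d / (1 + \<kappa>))"] by auto
    then have \<tau>d: "\<tau> * (1 + \<kappa>) < d"
      using \<open>\<kappa> > 0\<close> by (simp add: field_simps)
    \<comment> \<open>The calmness inclusion is applied to the base point \<open>x\<close>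
      itself.\<close>
    have "x \<in> S t \<inter> ball x \<delta>" using assms(3) \<open>\<delta> > 0\<close> by simp
    moreover have "t + \<tau> \<in> {t<..<t + \<epsilon>}" using \<tau> by simp
    ultimately obtain y b where y: "y \<in> S (t + \<tau>)" and b: "norm b < 1" and x: "x = y + (\<kappa> * \<tau>) *\<^sub>R b"
      using sub \<tau> by fastforce
    have "norm (y - x) = \<kappa> * \<tau> * norm b"
      using x \<tau> \<open>\<kappa> > 0\<close> by simp
    then have yx: "norm (y - x) \<le> \<kappa> * \<tau>"
      using b \<tau> \<open>\<kappa> > 0\<close> by (simp add: mult_left_le)
    have "norm (\<tau>, y - x) \<le> \<tau> + \<kappa> * \<tau>"
      using norm_Pair_le[of \<tau> "y - x"] yx \<tau> by simp
    then have nrm: "norm ((t + \<tau>, y) - (t, x)) \<le> \<tau> * (1 + \<kappa>)"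
      by (simp add: algebra_simps)
    have "(\<alpha>, - u) \<bullet> ((t + \<tau>, y) - (t, x)) \<le> e' * norm ((t + \<tau>, y) - (t, x))"
      using nrm \<tau>d y by (intro d) (auto simp: gph_def dist_norm)
    also have "\<dots> \<le> e' * (\<tau> * (1 + \<kappa>))"
      using nrm \<open>e' > 0\<close> by (intro mult_left_mono) auto
    also have "\<dots> = e * \<tau>"
      using \<open>\<kappa> > 0\<close> by (simp add: e'_def)
    finally have "\<alpha> * \<tau> - u \<bullet> (y - x) \<le> e * \<tau>" by simp
    moreover have "u \<bullet> (y - x) \<le> \<kappa> * \<tau>"
    proof -
      have "u \<bullet> (y - x) \<le> norm u * norm (y - x)" by (rule norm_cauchy_schwarz)
      also have "\<dots> \<le> norm (y - x)" using assms(2) by (simp add: mult_left_le_one_le)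
      finally show ?thesis using yx by simp
    qed
    ultimately have "\<alpha> * \<tau> \<le> (\<kappa> + e) * \<tau>" by (simp add: algebra_simps)
    then show ?thesis using \<tau> by simp
  qed
  then have "\<alpha> \<le> \<kappa>" by (rule field_le_epsilon)
  then show "ennreal (max 0 \<alpha>) \<le> ennreal \<kappa>"
    using \<open>\<kappa> > 0\<close> by (simp add: ennreal_leI)
qed

section \<open>Separation of a convex set from an open cone\<close>

text \<open>If \<open>C\<close> missed the cone, a rescaled separating normal would be polar to
  \<open>C\<close> with \<open>norm u \<le> 1\<close> and \<open>\<alpha> \<ge> \<kappa>\<close>,
  against \<open>polar\<close>.\<close>

lemma convex_meets_cone:
  fixes C :: "(real \<times> 'a::euclidean_space) set"
  assumes "convex C" "0 \<in> C" "\<kappa> > 0"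
    and polar: "\<And>\<alpha> u. (\<And>c. c \<in> C \<Longrightarrow> (\<alpha>, - u) \<bullet> c \<le> 0) \<Longrightarrow> norm u \<le> 1 \<Longrightarrow> \<alpha> < \<kappa>"
  shows "\<exists>s w. (s, w) \<in> C \<and> norm w < \<kappa> * s"
proof (rule ccontr)
  assume no: "\<not> ?thesis"
  define Q where "Q = {(s :: real, w :: 'a). norm w < \<kappa> * s}"
  have "convex Q"
  proof (rule convexI, clarsimp simp: Q_def)
    fix s1 s2 a b :: real and w1 w2 :: 'a
    assume w: "norm w1 < \<kappa> * s1" "norm w2 < \<kappa> * s2" and ab: "0 \<le> a" "0 \<le> b" "a + b = 1"
    have "norm (a *\<^sub>R w1 + b *\<^sub>R w2) \<le> a * norm w1 + b * norm w2"
      using norm_triangle_ineq[of "a *\<^sub>R w1" "b *\<^sub>R w2"] ab by simp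
    also have "\<dots> < a * (\<kappa> * s1) + b * (\<kappa> * s2)"
    \<comment> \<open>Strictness has to come from a positive weight; for \<open>a = 0\<close> all
      weight is on the second point.\<close>
    proof (cases "a = 0")
      case False
      then have "a * norm w1 < a * (\<kappa> * s1)" using ab w by simp
      moreover have "b * norm w2 \<le> b * (\<kappa> * s2)" using ab w by (simp add: mult_left_mono)
      ultimately show ?thesis by linarith
    qed (use w ab in auto)
    finally show "norm (a *\<^sub>R w1 + b *\<^sub>R w2) < \<kappa> * (a * s1 + b * s2)" by (simp add: algebra_simps)
  qed
  moreover have "C \<inter> Q = {}" using no by (auto simp: Q_def)
  moreover have "(1, 0) \<in> Q" using \<open>\<kappa> > 0\<close> by (simp add: Q_def)
  ultimately obtain a b where "a \<noteq> 0" and C: "\<And>c. c \<in> C \<Longrightarrow> a \<bullet> c \<le> b" and Q: "\<And>q. q \<in> Q \<Longrightarrow> b \<le> a \<bullet> q"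
    using separating_hyperplane_sets[of C Q] assms(1,2) by blast
  have "b \<ge> 0" using C[OF assms(2)] by simp
  obtain \<alpha> u where a: "a = (\<alpha>, - u)" by (metis minus_minus surj_pair)
  \<comment> \<open>The points \<open>(\<tau>, 0)\<close> of \<open>Q\<close> tend to the apex,
    which forces the separating level down to 0.\<close>
  have "b \<le> 0"
  proof (rule field_le_epsilon)
    fix e :: real assume "e > 0"
    define \<tau> where "\<tau> = e / (1 + \<bar>\<alpha>\<bar>)"
    have "\<tau> > 0" using \<open>e > 0\<close> by (simp add: \<tau>_def)
    then have "b \<le> \<alpha> * \<tau>" using Q[of "(\<tau>, 0)"] \<open>\<kappa> > 0\<close> by (simp add: Q_def a)
    also have "\<dots> \<le> (1 + \<bar>\<alpha>\<bar>) * \<tau>" using \<open>\<tau> > 0\<close> by (intro mult_right_mono) auto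
    also have "\<dots> = e" by (simp add: \<tau>_def)
    finally show "b \<le> 0 + e" by simp
  qed
  \<comment> \<open>The polar is a cone, so the separating normal may be rescaled before
    \<open>polar\<close> is applied.\<close>
  have pol: "(r * \<alpha>, - (r *\<^sub>R u)) \<bullet> c \<le> 0" if "r \<ge> 0" "c \<in> C" for r c
  proof -
    have "(r * \<alpha>, - (r *\<^sub>R u)) \<bullet> c = r * (a \<bullet> c)"
      by (cases c) (simp add: a algebra_simps)
    also have "\<dots> \<le> 0" using C[OF that(2)] \<open>b \<le> 0\<close> that(1) by (simp add: mult_nonneg_nonpos)
    finally show ?thesis .
  qed
  have ge: "u \<bullet> w \<le> \<alpha>" if "norm w < \<kappa>" for w
    using Q[of "(1, w)"] that \<open>b \<ge> 0\<close> by (simp add: Q_def a)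
  show False
  proof (cases "u = 0")
    case True
    then have "\<alpha> > 0"
      using ge[of 0] \<open>a \<noteq> 0\<close> \<open>\<kappa> > 0\<close> a by (auto simp: zero_prod_def)
    \<comment> \<open>A normal without space component is scaled to have time component exactly
      \<open>\<kappa>\<close>.\<close>
    with polar[of "(\<kappa> / \<alpha>) * \<alpha>" "(\<kappa> / \<alpha>) *\<^sub>R u", OF pol] \<open>\<kappa> > 0\<close> True show False by simp
  next
    case False
    define r where "r = 1 / norm u"
    have r: "r > 0" "norm (r *\<^sub>R u) \<le> 1" using False by (auto simp: r_def)
    then have "r * \<alpha> < \<kappa>" using polar[of "r * \<alpha>" "r *\<^sub>R u", OF pol] by auto
    \<comment> \<open>\<open>ge\<close> needs \<open>norm w < \<kappa>\<close>, so
      \<open>\<kappa>\<close> is approached from below, with \<open>w\<close> in the direction of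
      \<open>u\<close>.\<close>
    moreover have "\<kappa>' \<le> r * \<alpha>" if "0 < \<kappa>'" "\<kappa>' < \<kappa>" for \<kappa>'
    proof -
      have "u \<bullet> ((\<kappa>' * r) *\<^sub>R u) \<le> \<alpha>"
        using that False by (intro ge) (simp add: r_def)
      then have "\<kappa>' * r * (norm u)\<^sup>2 \<le> \<alpha>" by (simp add: power2_norm_eq_inner)
      then have "\<kappa>' * norm u \<le> \<alpha>" using False by (simp add: r_def power2_eq_square)
      then show ?thesis using False by (simp add: r_def field_simps)
    qed
    ultimately show False
      using \<open>\<kappa> > 0\<close> dense[of "max 0 (r * \<alpha>)" \<kappa>] by fastforce
  qed
qed

section \<open>Strict differentiability\<close>

text \<open>Continuity keeps \<open>g' y\<close> within \<open>e\<close> of \<open>g' y0\<close> on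
  a small ball, and the mean value inequality applies there by convexity. The estimate is uniform in
  both points because the calmness bound later varies the starting point.\<close>

lemma C1_strict_derivative:
  fixes g :: "'a::euclidean_space \<Rightarrow> 'b::euclidean_space" and g' :: "'a \<Rightarrow> 'a \<Rightarrow>\<^sub>L 'b"
  assumes "open V" "y0 \<in> V" "e > 0" "continuous_on V g'"
    and deriv: "\<And>y. y \<in> V \<Longrightarrow> (g has_derivative blinfun_apply (g' y)) (at y)"
  obtains r where "r > 0" "ball y0 r \<subseteq> V"
    "\<And>a b. a \<in> ball y0 r \<Longrightarrow> b \<in> ball y0 r \<Longrightarrow>
       norm (g b - g a - g' y0 (b - a)) \<le> e * norm (b - a)"
proof -
  obtain r1 where r1: "r1 > 0" "ball y0 r1 \<subseteq> V"
    using assms(1,2) openE by blast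
  obtain r2 where r2: "r2 > 0" "\<And>y. y \<in> V \<Longrightarrow> dist y y0 < r2 \<Longrightarrow> dist (g' y) (g' y0) < e"
    using assms(2-4) unfolding continuous_on_iff by meson
  define r where "r = min r1 r2"
  have r: "r > 0" "ball y0 r \<subseteq> V" using r1 r2 by (auto simp: r_def)
  have "norm (g b - g a - g' y0 (b - a)) \<le> norm (b - a) * e"
    if "a \<in> ball y0 r" "b \<in> ball y0 r" for a b
  proof (rule differentiable_bound_linearization[of a b "ball y0 r" g "\<lambda>y. blinfun_apply (g' y)"])
    show "a + \<theta> *\<^sub>R (b - a) \<in> ball y0 r" if "\<theta> \<in> {0..1}" for \<theta> :: real
      using convexD_alt[OF convex_ball \<open>a \<in> ball y0 r\<close> \<open>b \<in> ball y0 r\<close>, of \<theta>] that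
      by (simp add: algebra_simps)
    show "(g has_derivative blinfun_apply (g' y)) (at y within ball y0 r)" if "y \<in> ball y0 r" for y
      using deriv r that has_derivative_at_withinI by blast
    show "onorm (blinfun_apply (g' y) - blinfun_apply (g' y0)) \<le> e" if "y \<in> ball y0 r" for y
    proof -
      have "norm (g' y - g' y0) < e"
        using r2(2)[of y] that r by (auto simp: r_def dist_norm dist_commute norm_minus_commute)
      then show ?thesis
        by (simp add: norm_blinfun.rep_eq minus_blinfun.rep_eq fun_diff_def)
    qed
  qed (use r in auto)
  with that r show ?thesis by (simp add: mult.commute)
qed

section \<open>Normal cones in a convex chart\<close>

text \<open>Convexity of \<open>K\<close> is what subspaces and half-spaces share. The derivative
  \<open>g'\<close> is a parameter so that limits can be taken in it.\<close>

locale convex_chart =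
  fixes M U V K :: "'a::euclidean_space set" and p f g and g' :: "'a \<Rightarrow> 'a \<Rightarrow>\<^sub>L 'a"
  assumes p: "p \<in> M" "p \<in> U"
    and opens: "open U" "open V"
    and homeo: "homeomorphism U V f g"
    and C1_f: "C1_on U f"
    and deriv_g: "\<And>y. y \<in> V \<Longrightarrow> (g has_derivative blinfun_apply (g' y)) (at y)"
    and cont_g': "continuous_on V g'"
    and K: "convex K"
    and image: "f ` (U \<inter> M) = V \<inter> K"
begin

lemma f_mem: "q \<in> U \<Longrightarrow> q \<in> M \<Longrightarrow> f q \<in> V" "q \<in> U \<Longrightarrow> q \<in> M \<Longrightarrow> f q \<in> K"
  using image by blast+

lemma gf: "q \<in> U \<Longrightarrow> g (f q) = q"
  using homeo by (auto simp: homeomorphism_def)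

lemma g_mem: "y \<in> V \<Longrightarrow> y \<in> K \<Longrightarrow> g y \<in> M"
  using image gf by (metis IntE IntI imageE)

lemma segment_K: "y \<in> K \<Longrightarrow> z \<in> K \<Longrightarrow> 0 \<le> \<theta> \<Longrightarrow> \<theta> \<le> 1 \<Longrightarrow> y + \<theta> *\<^sub>R (z - y) \<in> K"
  using convexD_alt[OF K, of y z \<theta>] by (simp add: algebra_simps)

lemma isCont_f: "q \<in> U \<Longrightarrow> isCont f q"
  using C1_f unfolding C1_on_def by (meson has_derivative_continuous)

text \<open>By convexity the curve \<open>h\<close> leaves \<open>q\<close> inside \<open>M\<close>
  for small \<open>\<theta> > 0\<close>, with velocity \<open>D\<close>, and a Frechet normal cannot
  have a positive product with it. All \<open>q\<close> in the chart are covered because limiting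
  normals arise from nearby points.\<close>

lemma frechet_polar:
  assumes q: "q \<in> M" "q \<in> U" and v: "v \<in> frechet_normal_cone M q" and z: "z \<in> K"
  shows "v \<bullet> g' (f q) (z - f q) \<le> 0"
proof -
  define y D where "y = f q" and "D = g' y (z - y)"
  have y: "y \<in> V" "y \<in> K" "g y = q" using q f_mem gf by (auto simp: y_def)
  define h where "h = (\<lambda>\<theta>. g (y + \<theta> *\<^sub>R (z - y)))"
  have "(h has_vector_derivative D) (at 0)"
  proof -
    have "((\<lambda>\<theta>. y + \<theta> *\<^sub>R (z - y)) has_vector_derivative (z - y)) (at (0::real))"
      by (auto intro!: derivative_eq_intros)
    moreover have "(g has_derivative blinfun_apply (g' y)) (at (y + 0 *\<^sub>R (z - y)))"
      using deriv_g y by simp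
    ultimately have "(g \<circ> (\<lambda>\<theta>. y + \<theta> *\<^sub>R (z - y)) has_vector_derivative D) (at 0)"
      unfolding D_def by (metis vector_derivative_diff_chain_within[where S=UNIV] has_derivative_at_withinI)
    then show ?thesis by (simp add: h_def o_def)
  qed
  then have hD: "(h has_vector_derivative D) (at_right 0)"
    by (rule has_vector_derivative_at_within)
  have "h 0 = q" using y by (simp add: h_def)
  then have cont: "(h \<longlongrightarrow> q) (at_right 0)"
    using has_vector_derivative_continuous[OF hD] by (simp add: continuous_within)
  have "((\<lambda>\<theta>. norm (h \<theta> - q - \<theta> *\<^sub>R D) / norm \<theta>) \<longlongrightarrow> 0) (at_right 0)"
    using hD \<open>h 0 = q\<close> unfolding has_vector_derivative_def has_derivative_iff_norm by simp
  moreover have "eventually (\<lambda>\<theta>::real. \<theta> > 0) (at_right 0)"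
    by (rule eventually_at_right_less)
  then have "eventually (\<lambda>\<theta>. norm (h \<theta> - q - \<theta> *\<^sub>R D) / norm \<theta> = norm ((h \<theta> - q) /\<^sub>R \<theta> - D)) (at_right 0)"
  proof eventually_elim
    case (elim \<theta>)
    then have "(h \<theta> - q) /\<^sub>R \<theta> - D = (h \<theta> - q - \<theta> *\<^sub>R D) /\<^sub>R \<theta>"
      by (simp add: scaleR_diff_right)
    with elim show ?case by (simp add: divide_inverse mult.commute)
  qed
  ultimately have "((\<lambda>\<theta>. norm ((h \<theta> - q) /\<^sub>R \<theta> - D)) \<longlongrightarrow> 0) (at_right 0)"
    by (rule Lim_transform_eventually)
  then have lim: "((\<lambda>\<theta>. (h \<theta> - q) /\<^sub>R \<theta>) \<longlongrightarrow> D) (at_right 0)"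
    using Lim_null tendsto_norm_zero_iff by blast
  \<comment> \<open>The Frechet inequality along \<open>h\<close>, divided by
    \<open>\<theta>\<close>, passes to the limit.\<close>
  have "v \<bullet> D \<le> e * norm D" if "e > 0" for e
  proof (rule tendsto_le[OF _ tendsto_mult[OF tendsto_const tendsto_norm[OF lim]] tendsto_inner[OF tendsto_const lim]])
    obtain d where "d > 0" and d: "\<And>y. y \<in> M \<Longrightarrow> dist y q < d \<Longrightarrow> v \<bullet> (y - q) \<le> e * norm (y - q)"
      using v \<open>e > 0\<close> unfolding frechet_normal_cone_iff by meson
    have "eventually (\<lambda>\<theta>. dist (h \<theta>) q < d) (at_right 0)"
      using cont \<open>d > 0\<close> by (rule tendstoD)
    moreover have "((\<lambda>\<theta>. y + \<theta> *\<^sub>R (z - y)) \<longlongrightarrow> y + 0 *\<^sub>R (z - y)) (at_right (0::real))"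
      by (intro tendsto_intros)
    then have "eventually (\<lambda>\<theta>. y + \<theta> *\<^sub>R (z - y) \<in> V) (at_right (0::real))"
      using topological_tendstoD opens y by fastforce
    moreover have "eventually (\<lambda>\<theta>. \<theta> \<in> {0<..<1::real}) (at_right 0)"
      by (rule eventually_at_right_real) simp
    ultimately show "eventually (\<lambda>\<theta>. v \<bullet> ((h \<theta> - q) /\<^sub>R \<theta>) \<le> e * norm ((h \<theta> - q) /\<^sub>R \<theta>)) (at_right 0)"
    proof eventually_elim
      case (elim \<theta>)
      then have "v \<bullet> (h \<theta> - q) \<le> e * norm (h \<theta> - q)"
        using g_mem segment_K[OF y(2) z] by (intro d) (auto simp: h_def)
      with elim show ?case by (auto simp: divide_simps mult.commute)
    qed
  qed simp
  then have "v \<bullet> D \<le> 0 + e" if "e > 0" for e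
  proof -
    \<comment> \<open>The summand 1 covers the case \<open>D = 0\<close>.\<close>
    have "v \<bullet> D \<le> (e / (1 + norm D)) * norm D"
      using that by (intro \<open>\<And>e. e > 0 \<Longrightarrow> v \<bullet> D \<le> e * norm D\<close>) (auto intro!: divide_pos_pos add_pos_nonneg)
    also have "\<dots> \<le> (e / (1 + norm D)) * (1 + norm D)"
      using that by (intro mult_left_mono) (auto intro!: divide_nonneg_pos add_pos_nonneg)
    also have "\<dots> = e" using norm_ge_zero[of D] by (simp add: add_nonneg_eq_0_iff)
    finally show ?thesis by simp
  qed
  then show ?thesis unfolding D_def y_def by (rule field_le_epsilon)
qed

text \<open>The polar inequality survives limits since \<open>f\<close> and \<open>g'\<close> are
  continuous and the same \<open>K\<close> serves all nearby points.\<close>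

lemma limiting_polar:
  assumes v: "v \<in> limiting_normal_cone M p" and z: "z \<in> K"
  shows "v \<bullet> g' (f p) (z - f p) \<le> 0"
proof -
  obtain xs vs where xs: "\<And>i. xs i \<in> M" "xs \<longlonglongrightarrow> p"
    and vs: "\<And>i. vs i \<in> frechet_normal_cone M (xs i)" "vs \<longlonglongrightarrow> v"
    using v unfolding limiting_normal_cone_def by blast
  have "f p \<in> V" using f_mem p by blast
  have fl: "(\<lambda>i. f (xs i)) \<longlonglongrightarrow> f p"
    using isCont_f p xs(2) isCont_tendsto_compose by blast
  have "isCont g' (f p)"
    using cont_g' opens \<open>f p \<in> V\<close> continuous_on_eq_continuous_at by blast
  then have "(\<lambda>i. g' (f (xs i))) \<longlonglongrightarrow> g' (f p)"
    using fl isCont_tendsto_compose by blast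
  then have "(\<lambda>i. vs i \<bullet> g' (f (xs i)) (z - f (xs i))) \<longlonglongrightarrow> v \<bullet> g' (f p) (z - f p)"
    using vs(2) fl by (intro tendsto_intros)
  moreover have "eventually (\<lambda>i. xs i \<in> U) sequentially"
    using xs(2) opens(1) p(2) by (rule topological_tendstoD)
  then have "eventually (\<lambda>i. vs i \<bullet> g' (f (xs i)) (z - f (xs i)) \<le> 0) sequentially"
    by eventually_elim (use frechet_polar xs vs z in blast)
  ultimately show ?thesis
    by (rule tendsto_upperbound) simp
qed

text \<open>With \<open>limiting_polar\<close> this makes every limiting normal at \<open>p\<close>
  a Frechet normal. Expanding \<open>g\<close> at \<open>f p\<close> writes \<open>y - p\<close> as
  a vector on which \<open>v\<close> is nonpositive plus a remainder \<open>R\<close> that is small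
  relative to \<open>y - p\<close>.\<close>

lemma polar_frechet:
  assumes v: "\<And>z. z \<in> K \<Longrightarrow> v \<bullet> g' (f p) (z - f p) \<le> 0"
  shows "v \<in> frechet_normal_cone M p"
  unfolding frechet_normal_cone_iff
proof (intro allI impI)
  fix e :: real assume "e > 0"
  have fp: "f p \<in> V" using f_mem p by blast
  obtain f' where f': "(f has_derivative f') (at p)"
    using C1_f p unfolding C1_on_def by blast
  obtain B where "B > 0" and B: "\<And>h. norm (f' h) \<le> norm h * B"
    using bounded_linear.pos_bounded[OF has_derivative_bounded_linear[OF f']] by blast
  \<comment> \<open>Tolerance 1 is enough to bound the growth of \<open>f\<close> at
    \<open>p\<close> by the factor \<open>1 + B\<close>.\<close>
  obtain d1 where "d1 > 0" and d1: "\<And>y. norm (y - p) < d1 \<Longrightarrow> norm (f y - f p - f' (y - p)) \<le> 1 * norm (y - p)"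
    using f' unfolding has_derivative_at_alt by (metis zero_less_one)
  \<comment> \<open>This compensates the growth factor of \<open>f\<close> and the factor
    \<open>norm v\<close> from Cauchy-Schwarz.\<close>
  define e' where "e' = e / ((1 + norm v) * (1 + B))"
  have "(1 + norm v) * (1 + B) > 0"
    using \<open>B > 0\<close> norm_ge_zero[of v] by (intro mult_pos_pos) linarith+
  then have e': "e' > 0" "(1 + norm v) * (e' * (1 + B)) = e"
    using \<open>e > 0\<close> by (auto simp: e'_def)
  obtain r where "r > 0" and r: "\<And>y. norm (y - f p) < r \<Longrightarrow>
      norm (g y - g (f p) - g' (f p) (y - f p)) \<le> e' * norm (y - f p)"
    using deriv_g[OF fp] e'(1) unfolding has_derivative_at_alt by metis
  obtain d2 where "d2 > 0" and d2: "\<And>y. dist y p < d2 \<Longrightarrow> dist (f y) (f p) < r"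
    using isCont_f[OF p(2)] \<open>r > 0\<close> unfolding continuous_at_eps_delta by blast
  obtain d3 where "d3 > 0" and d3: "ball p d3 \<subseteq> U"
    using opens p openE by blast
  have "v \<bullet> (y - p) \<le> e * norm (y - p)" if "y \<in> M" "dist y p < min d1 (min d2 d3)" for y
  proof -
    have "y \<in> U" using that d3 by (auto simp: dist_commute)
    have "norm (f y - f p) \<le> norm (f y - f p - f' (y - p)) + norm (f' (y - p))"
      by (metis norm_triangle_sub add.commute)
    also have "\<dots> \<le> (1 + B) * norm (y - p)"
      using d1[of y] B[of "y - p"] that by (simp add: dist_norm algebra_simps)
    finally have fb: "norm (f y - f p) \<le> (1 + B) * norm (y - p)" .
    define R where "R = y - p - g' (f p) (f y - f p)"
    have "norm R \<le> e' * norm (f y - f p)"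
      using r[of "f y"] d2[of y] that gf p \<open>y \<in> U\<close> by (simp add: R_def dist_norm)
    also have "\<dots> \<le> e' * ((1 + B) * norm (y - p))"
      using fb e' by (intro mult_left_mono) auto
    finally have R: "norm R \<le> e' * ((1 + B) * norm (y - p))" .
    have "v \<bullet> (y - p) = v \<bullet> g' (f p) (f y - f p) + v \<bullet> R"
      by (simp add: R_def inner_diff_right)
    also have "\<dots> \<le> norm v * norm R"
      using v[of "f y"] f_mem \<open>y \<in> U\<close> that norm_cauchy_schwarz[of v R] by fastforce
    also have "\<dots> \<le> (1 + norm v) * (e' * ((1 + B) * norm (y - p)))"
      using R by (intro mult_mono) auto
    also have "\<dots> = e * norm (y - p)"
      using e'(2) by (metis mult.assoc)
    finally show ?thesis .
  qed
  then show "\<exists>d>0. \<forall>y\<in>M. dist y p < d \<longrightarrow> v \<bullet> (y - p) \<le> e * norm (y - p)"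
    using \<open>d1 > 0\<close> \<open>d2 > 0\<close> \<open>d3 > 0\<close> by (intro exI[of _ "min d1 (min d2 d3)"]) auto
qed

end

section \<open>Upper bound for calmness from one tangent direction\<close>

text \<open>The strict inequality \<open>norm w < \<kappa> * s\<close> leaves room for the
  linearization error and for a change of starting point, so one direction found at \<open>x\<close>
  serves all points of \<open>S t\<close> near \<open>x\<close>.\<close>

lemma calm_up_le_tangent:
  fixes S :: "real \<Rightarrow> 'a::euclidean_space set"
  assumes chart: "convex_chart (gph S) U V K (t, x) f g g'"
    and z: "z \<in> K" and sw: "g' (f (t, x)) (z - f (t, x)) = (s, w)" "s > 0" "norm w < \<kappa> * s"
  shows "calm_up S t x \<le> ennreal \<kappa>"
proof -
  interpret convex_chart "gph S" U V K "(t, x)" f g g' by (rule chart)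
  define y0 where "y0 = f (t, x)"
  have y0: "y0 \<in> V" using f_mem p by (simp add: y0_def)
  have "\<kappa> > 0" using sw(2,3) norm_ge_zero[of w] by (smt (verit) zero_less_mult_pos2)
  \<comment> \<open>Admissible velocities: the bound \<open>s / 2\<close> gives all paths a common
    time horizon, and openness provides the error tolerance \<open>r\<close>.\<close>
  define Q where "Q = {a :: real \<times> 'a. s / 2 < fst a \<and> norm (snd a) < \<kappa> * fst a}"
  have "open Q" unfolding Q_def
    by (intro open_Collect_conj open_Collect_less continuous_intros)
  moreover have "(s, w) \<in> Q" using sw by (simp add: Q_def)
  ultimately obtain r where "r > 0" and r: "ball (s, w) r \<subseteq> Q" using openE by blast
  \<comment> \<open>Bounds \<open>norm (z - y)\<close> for all \<open>y\<close> within 1 of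
    \<open>y0\<close>; the tolerance \<open>r / (2 * D)\<close> then costs less than
    \<open>r / 2\<close>.\<close>
  define D where "D = norm (z - y0) + 1"
  have "D > 0" by (simp add: D_def add_nonneg_pos)
  obtain r2 where "r2 > 0" and r2: "ball y0 r2 \<subseteq> V"
    "\<And>a b. a \<in> ball y0 r2 \<Longrightarrow> b \<in> ball y0 r2 \<Longrightarrow> norm (g b - g a - g' y0 (b - a)) \<le> r / (2 * D) * norm (b - a)"
    using C1_strict_derivative[OF opens(2) y0, of "r / (2 * D)" g' g] cont_g' deriv_g \<open>r > 0\<close> \<open>D > 0\<close>
    by (metis divide_pos_pos mult_pos_pos zero_less_numeral)
  \<comment> \<open>The bound 1 keeps paths in \<open>K\<close>; the other limits their length in
    the chart to \<open>r2 / 2\<close>.\<close>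
  define \<theta>0 where "\<theta>0 = min 1 (r2 / (2 * D))"
  have \<theta>0: "0 < \<theta>0" "\<theta>0 \<le> 1" using \<open>r2 > 0\<close> \<open>D > 0\<close> by (auto simp: \<theta>0_def)
  have "\<theta>0 * D \<le> r2 / (2 * D) * D" using \<open>D > 0\<close> by (intro mult_right_mono) (auto simp: \<theta>0_def)
  then have \<theta>0D: "\<theta>0 * D \<le> r2 / 2" using \<open>D > 0\<close> by simp
  \<comment> \<open>The three bounds serve, in order, \<open>D\<close>, the ball of radius
    \<open>r2\<close>, and the shift of the starting point, which may cost
    \<open>r / 2\<close>.\<close>
  define \<delta>1 where "\<delta>1 = min 1 (min (r2 / 2) (r / (2 * (1 + norm (g' y0)))))"
  have N: "1 + norm (g' y0) > 0" by (simp add: add_pos_nonneg)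
  then have "r / (2 * (1 + norm (g' y0))) > 0"
    using \<open>r > 0\<close> by (intro divide_pos_pos mult_pos_pos) auto
  then have "\<delta>1 > 0" using \<open>r2 > 0\<close> unfolding \<delta>1_def by (intro min_less_iff_conj[THEN iffD2] conjI) auto
  moreover have "\<delta>1 \<le> 1" "\<delta>1 \<le> r2 / 2" "\<delta>1 \<le> r / (2 * (1 + norm (g' y0)))"
    unfolding \<delta>1_def by (meson min.cobounded1 min.cobounded2 order_trans)+
  ultimately have \<delta>1: "\<delta>1 > 0" "\<delta>1 \<le> 1" "\<delta>1 \<le> r2 / 2" "\<delta>1 \<le> r / (2 * (1 + norm (g' y0)))"
    by blast+
  have step: "y + \<theta> *\<^sub>R (z - y) \<in> ball y0 r2 \<and> (\<theta> > 0 \<longrightarrow> (g (y + \<theta> *\<^sub>R (z - y)) - g y) /\<^sub>R \<theta> \<in> Q)"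
    if "dist y y0 < \<delta>1" "0 \<le> \<theta>" "\<theta> \<le> \<theta>0" for y \<theta>
  proof -
    have yy: "norm (y - y0) < \<delta>1" using that by (simp add: dist_norm)
    have "norm (z - y) \<le> norm (z - y0) + norm (y - y0)"
      by (metis norm_triangle_sub norm_triangle_ineq4 diff_diff_eq2 diff_add_cancel add.commute diff_right_commute)
    then have zy: "norm (z - y) < D" using yy \<delta>1 by (simp add: D_def)
    have "\<theta> * norm (z - y) \<le> \<theta>0 * D"
      using that zy by (intro mult_mono) auto
    then have "norm (\<theta> *\<^sub>R (z - y)) \<le> \<theta>0 * D" using that(2) by simp
    moreover have "norm (y - y0 + \<theta> *\<^sub>R (z - y)) \<le> norm (y - y0) + norm (\<theta> *\<^sub>R (z - y))"
      by (rule norm_triangle_ineq)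
    ultimately have "norm (y - y0 + \<theta> *\<^sub>R (z - y)) < r2"
      using yy \<delta>1(3) \<theta>0D by argo
    then have in1: "y + \<theta> *\<^sub>R (z - y) \<in> ball y0 r2"
      by (metis mem_ball dist_commute dist_norm diff_add_eq)
    have in0: "y \<in> ball y0 r2" using that \<delta>1 \<open>r2 > 0\<close> by (simp add: dist_commute)
    have "(g (y + \<theta> *\<^sub>R (z - y)) - g y) /\<^sub>R \<theta> \<in> Q" if "\<theta> > 0"
    proof -
      define E where "E = g (y + \<theta> *\<^sub>R (z - y)) - g y - g' y0 (\<theta> *\<^sub>R (z - y))"
      have "norm E \<le> r / (2 * D) * norm (\<theta> *\<^sub>R (z - y))"
        using r2(2)[OF in0 in1] by (simp add: E_def)
      also have "\<dots> = \<theta> * (r / (2 * D) * norm (z - y))" using that by simp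
      finally have "norm (E /\<^sub>R \<theta>) \<le> r / (2 * D) * norm (z - y)"
        using that by (simp add: field_simps)
      also have "\<dots> < r / (2 * D) * D"
        using zy \<open>r > 0\<close> \<open>D > 0\<close> by (intro mult_strict_left_mono) auto
      also have "\<dots> = r / 2" using \<open>D > 0\<close> by simp
      finally have E: "norm (E /\<^sub>R \<theta>) < r / 2" .
      have "norm (g' y0 (y0 - y)) \<le> norm (g' y0) * norm (y0 - y)"
        by (rule norm_blinfun)
      also have "\<dots> \<le> (1 + norm (g' y0)) * \<delta>1"
        using yy N by (intro mult_mono) (auto simp: norm_minus_commute)
      also have "\<dots> \<le> (1 + norm (g' y0)) * (r / (2 * (1 + norm (g' y0))))"
        using \<delta>1(4) N by (intro mult_left_mono) auto
      also have "\<dots> = r / 2"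
      proof -
        have "c * (r / (2 * c)) = r / 2" if "c > 0" for c :: real using that by simp
        from this[OF N] show ?thesis .
      qed
      finally have G: "norm (g' y0 (y0 - y)) \<le> r / 2" .
      \<comment> \<open>The quotient departs from \<open>(s, w)\<close> by the linearization error
        and by \<open>g' y0 (y0 - y)\<close>, each using half of \<open>r\<close>.\<close>
      have "g (y + \<theta> *\<^sub>R (z - y)) - g y = E + \<theta> *\<^sub>R g' y0 (z - y)"
        by (simp only: E_def blinfun.scaleR_right diff_add_cancel)
      then have "(g (y + \<theta> *\<^sub>R (z - y)) - g y) /\<^sub>R \<theta> = E /\<^sub>R \<theta> + g' y0 (z - y)"
        using that by (simp add: scaleR_add_right)
      also have "g' y0 (z - y) = g' y0 (z - y0) + g' y0 (y0 - y)"
        by (simp flip: blinfun.add_right)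
      also have "g' y0 (z - y0) = (s, w)" using sw(1) by (simp only: y0_def)
      finally have "(g (y + \<theta> *\<^sub>R (z - y)) - g y) /\<^sub>R \<theta> - (s, w) = E /\<^sub>R \<theta> + g' y0 (y0 - y)"
        by simp
      then have "dist (s, w) ((g (y + \<theta> *\<^sub>R (z - y)) - g y) /\<^sub>R \<theta>) < r"
        using E G norm_triangle_ineq[of "E /\<^sub>R \<theta>" "g' y0 (y0 - y)"]
        unfolding dist_norm by (subst norm_minus_commute) simp
      then show ?thesis using r by auto
    qed
    with in1 show ?thesis by blast
  qed
  obtain d2 where "d2 > 0" and d2: "\<And>q. dist q (t, x) < d2 \<Longrightarrow> dist (f q) y0 < \<delta>1"
    using isCont_f[OF p(2)] \<open>\<delta>1 > 0\<close> unfolding continuous_at_eps_delta y0_def by blast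
  obtain d3 where "d3 > 0" and d3: "ball (t, x) d3 \<subseteq> U"
    using opens p openE by blast
  define \<delta> where "\<delta> = min d2 d3"
  \<comment> \<open>At parameter \<open>\<theta>0\<close> every path has advanced by more than
    \<open>\<theta>0 * s / 2\<close> in time.\<close>
  define \<epsilon> where "\<epsilon> = \<theta>0 * s / 2"
  have "\<delta> > 0" "\<epsilon> > 0" using \<open>d2 > 0\<close> \<open>d3 > 0\<close> \<theta>0 sw by (auto simp: \<delta>_def \<epsilon>_def)
  have "\<exists>y1 b. y = y1 + (\<kappa> * \<bar>t1 - t\<bar>) *\<^sub>R b \<and> y1 \<in> S t1 \<and> b \<in> ball 0 1"
    if t1: "t < t1" "t1 < t + \<epsilon>" and y: "y \<in> S t" "dist x y < \<delta>" for t1 y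
  proof -
    define \<eta> where "\<eta> = f (t, y)"
    have dq: "dist (t, y) (t, x) < \<delta>" using y by (simp add: dist_Pair_Pair dist_commute)
    then have yU: "(t, y) \<in> U" using d3 by (auto simp: \<delta>_def dist_commute)
    have yM: "(t, y) \<in> gph S" using y by (simp add: gph_def)
    have \<eta>: "dist \<eta> y0 < \<delta>1" "\<eta> \<in> K" "g \<eta> = (t, y)"
      using d2[of "(t, y)"] dq yU yM f_mem gf by (auto simp: \<eta>_def \<delta>_def)
    define \<gamma> where "\<gamma> = (\<lambda>\<theta>. g (\<eta> + \<theta> *\<^sub>R (z - \<eta>)))"
    have cont: "continuous_on {0..\<theta>0} \<gamma>"
      unfolding \<gamma>_def
    proof (rule continuous_on_compose2[of V g])
      show "continuous_on V g" using homeo by (simp add: homeomorphism_def)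
      show "(\<lambda>\<theta>. \<eta> + \<theta> *\<^sub>R (z - \<eta>)) ` {0..\<theta>0} \<subseteq> V"
        using step[OF \<eta>(1)] r2(1) by auto
    qed (intro continuous_intros)
    have \<gamma>Q: "s / 2 * \<theta> < fst (\<gamma> \<theta>) - t \<and> norm (snd (\<gamma> \<theta>) - y) < \<kappa> * (fst (\<gamma> \<theta>) - t)"
      if "0 < \<theta>" "\<theta> \<le> \<theta>0" for \<theta>
    proof -
      define a where "a = (\<gamma> \<theta> - (t, y)) /\<^sub>R \<theta>"
      have "a \<in> Q" using step[OF \<eta>(1), of \<theta>] that \<eta>(3) by (simp add: \<gamma>_def a_def)
      then have *: "s / 2 < fst a" "norm (snd a) < \<kappa> * fst a" by (simp_all add: Q_def)
      have "\<gamma> \<theta> - (t, y) = \<theta> *\<^sub>R a" using that by (simp add: a_def)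
      then have **: "fst (\<gamma> \<theta>) - t = \<theta> * fst a" "snd (\<gamma> \<theta>) - y = \<theta> *\<^sub>R snd a"
        by (metis fst_diff fst_conv fst_scaleR real_scaleR_def, metis snd_diff snd_conv snd_scaleR)
      have "\<theta> * (s / 2) < \<theta> * fst a" "\<theta> * norm (snd a) < \<theta> * (\<kappa> * fst a)"
        using * that by simp_all
      then show ?thesis unfolding ** using that by (simp add: mult_ac)
    qed
    \<comment> \<open>The intermediate value theorem finds the parameter at which the path is
      exactly at time \<open>t1\<close>.\<close>
    have "t1 \<le> fst (\<gamma> \<theta>0)"
      using \<gamma>Q[of \<theta>0] t1 \<theta>0 by (simp add: \<epsilon>_def mult.commute)
    moreover have "fst (\<gamma> 0) \<le> t1" using t1 \<eta>(3) by (simp add: \<gamma>_def)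
    ultimately obtain \<theta> where \<theta>: "0 \<le> \<theta>" "\<theta> \<le> \<theta>0" "fst (\<gamma> \<theta>) = t1"
      using IVT'[OF _ _ less_imp_le[OF \<theta>0(1)] continuous_on_fst[OF cont], of t1] by blast
    have "\<theta> \<noteq> 0" using \<theta>(3) t1 \<eta>(3) by (auto simp: \<gamma>_def)
    then have "\<theta> > 0" using \<theta> by simp
    define y1 where "y1 = snd (\<gamma> \<theta>)"
    have "\<eta> + \<theta> *\<^sub>R (z - \<eta>) \<in> V" using step[OF \<eta>(1) \<theta>(1,2)] r2(1) by blast
    then have "\<gamma> \<theta> \<in> gph S"
      using g_mem segment_K[OF \<eta>(2) z \<theta>(1)] \<theta>(2) \<theta>0(2) by (simp add: \<gamma>_def)
    then have "y1 \<in> S t1" using \<theta>(3) by (auto simp: gph_def y1_def)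
    have less: "norm (y1 - y) < \<kappa> * (t1 - t)"
      using \<gamma>Q[OF \<open>\<theta> > 0\<close> \<theta>(2)] \<theta>(3) by (simp add: y1_def)
    define b where "b = (y - y1) /\<^sub>R (\<kappa> * (t1 - t))"
    have pos: "\<kappa> * (t1 - t) > 0" using \<open>\<kappa> > 0\<close> t1 by simp
    have "norm b = norm (y1 - y) / (\<kappa> * (t1 - t))"
      unfolding b_def norm_scaleR abs_inverse abs_of_pos[OF pos] divide_inverse norm_minus_commute[of y y1]
      by (rule mult.commute)
    then have "norm b < 1" using less pos by simp
    moreover have "c *\<^sub>R ((y - y1) /\<^sub>R c) = y - y1" if "c > 0" for c :: real
      using that by simp
    from this[OF pos] have "y = y1 + (\<kappa> * \<bar>t1 - t\<bar>) *\<^sub>R b"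
      using t1 by (simp only: b_def abs_of_pos diff_gt_0_iff_gt add_diff_eq add_diff_cancel_left')
    ultimately show ?thesis using \<open>y1 \<in> S t1\<close> by auto
  qed
  then have "\<forall>t1\<in>{t<..<t + \<epsilon>}. S t \<inter> ball x \<delta> \<subseteq> {y + (\<kappa> * \<bar>t1 - t\<bar>) *\<^sub>R b | y b. y \<in> S t1 \<and> b \<in> ball 0 1}"
    by auto
  then show ?thesis
    unfolding calm_up_def using \<open>\<kappa> > 0\<close> \<open>\<delta> > 0\<close> \<open>\<epsilon> > 0\<close> by (intro Inf_lower) blast
qed

section \<open>Equality of the two moduli\<close>

theorem calm_up_eq_asym_modulus:
  fixes S :: "real \<Rightarrow> 'a::euclidean_space set"
  assumes chart: "convex_chart (gph S) U V K (t, x) f g g'"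
    and fin: "asym_modulus S t x < \<infinity>"
  shows "calm_up S t x = asym_modulus S t x"
proof (rule antisym)
  interpret convex_chart "gph S" U V K "(t, x)" f g g' by (rule chart)
  have "x \<in> S t" using p by (simp add: gph_def)
  show "asym_modulus S t x \<le> calm_up S t x"
    unfolding asym_modulus_def
  proof (rule Sup_least, clarify)
    fix \<alpha> u assume "\<alpha> \<in> coderivative S t x u" "norm u \<le> 1"
    \<comment> \<open>The limiting normal is polar, hence already a Frechet normal.\<close>
    then show "ennreal (max 0 \<alpha>) \<le> calm_up S t x"
      using limiting_polar polar_frechet calm_up_ge_frechet \<open>x \<in> S t\<close>
      unfolding coderivative_def by blast
  qed
  show "calm_up S t x \<le> asym_modulus S t x"
  proof (rule ennreal_le_epsilon)
    fix e :: real assume "e > 0"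
    obtain m where m: "asym_modulus S t x = ennreal m" "m \<ge> 0"
      using fin by (cases "asym_modulus S t x") auto
    define \<kappa> where "\<kappa> = m + e"
    have "\<kappa> > 0" using m \<open>e > 0\<close> by (simp add: \<kappa>_def)
    define A where "A = blinfun_apply (g' (f (t, x)))"
    have "linear A" unfolding A_def by (simp add: blinfun.bounded_linear_right bounded_linear.linear)
    define C where "C = A ` ((\<lambda>z. z - f (t, x)) ` K)"
    have "convex C" unfolding C_def
      by (intro convex_linear_image \<open>linear A\<close> convex_translation_subtract K)
    moreover have "0 \<in> C"
      using f_mem(2) p \<open>linear A\<close> by (force simp: C_def linear_0)
    \<comment> \<open>A vector polar to \<open>C\<close> is a normal at \<open>(t, x)\<close>, so
      the modulus bounds \<open>\<alpha>\<close> by \<open>m\<close>, which is below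
      \<open>\<kappa>\<close>.\<close>
    moreover have "\<alpha> < \<kappa>" if pol: "\<And>c. c \<in> C \<Longrightarrow> (\<alpha>, - u) \<bullet> c \<le> 0" and u: "norm u \<le> 1" for \<alpha> u
    proof -
      have "(\<alpha>, - u) \<in> frechet_normal_cone (gph S) (t, x)"
        using pol by (intro polar_frechet) (auto simp: C_def A_def)
      then have "\<alpha> \<in> coderivative S t x u"
        using frechet_subset_limiting p(1) unfolding coderivative_def by blast
      then have "ennreal (max 0 \<alpha>) \<le> ennreal m"
        unfolding m(1)[symmetric] asym_modulus_def using u by (intro Sup_upper) blast
      then show ?thesis using m(2) \<open>e > 0\<close> by (simp add: \<kappa>_def)
    qed
    ultimately obtain s w where sw: "(s, w) \<in> C" "norm w < \<kappa> * s"
      using convex_meets_cone[OF _ _ \<open>\<kappa> > 0\<close>] by blast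
    then have "\<kappa> * s > 0" by (meson le_less_trans norm_ge_zero)
    then have "s > 0" using \<open>\<kappa> > 0\<close> zero_less_mult_pos by blast
    obtain z where "z \<in> K" "g' (f (t, x)) (z - f (t, x)) = (s, w)"
      using sw(1) by (auto simp: C_def A_def)
    then have "calm_up S t x \<le> ennreal \<kappa>"
      using calm_up_le_tangent[OF chart] \<open>s > 0\<close> sw(2) by blast
    then show "calm_up S t x \<le> asym_modulus S t x + ennreal e"
      using m \<open>e > 0\<close> by (simp add: \<kappa>_def)
  qed
qed

theorem proposition23:
  fixes S :: "real \<Rightarrow> (real ^ 'n) set" and t :: real and x :: "real ^ 'n"
  assumes "smooth_sweeping_process S"
    and "t \<in> mdom S"
    and "ereal t \<noteq> (SUP s\<in>mdom S. ereal s)"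
    and "x \<in> S t"
    and "asym_modulus S t x < \<infinity>"
  shows "calm_up S t x = asym_modulus S t x"
proof -
  have p: "(t, x) \<in> gph S" using assms(4) by (simp add: gph_def)
  \<comment> \<open>\<open>K\<close> is the subspace of a submanifold chart or the half-space of a
    boundary chart.\<close>
  obtain U V K :: "(real \<times> (real ^ 'n)) set" and f g where "(t, x) \<in> U" "C1_diffeomorphism U V f g" "convex K"
    "f ` (U \<inter> gph S) = V \<inter> K"
  proof (cases "\<exists>k. C1_submanifold k (gph S)")
    case True
    then obtain U V L :: "(real \<times> (real ^ 'n)) set" and f g where "(t, x) \<in> U" "C1_diffeomorphism U V f g" "subspace L"
      "f ` (U \<inter> gph S) = V \<inter> L"
      unfolding C1_submanifold_def using p by meson
    then show ?thesis using that subspace_imp_convex by blast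
  next
    case False
    then have "full_dim_C1_manifold_with_boundary (gph S)"
      using assms(1) unfolding smooth_sweeping_process_def by blast
    then obtain U V f g and b :: "real \<times> (real ^ 'n)" where "(t, x) \<in> U" "C1_diffeomorphism U V f g"
      "f ` (U \<inter> gph S) = V \<inter> {y. 0 \<le> b \<bullet> y}"
      unfolding full_dim_C1_manifold_with_boundary_def using p by meson
    then show ?thesis using that convex_halfspace_ge[of 0 b] by blast
  qed
  moreover from this obtain g' where "\<forall>y\<in>V. (g has_derivative blinfun_apply (g' y)) (at y)"
    "continuous_on V g'"
    unfolding C1_diffeomorphism_def C1_on_def by blast
  ultimately have "convex_chart (gph S) U V K (t, x) f g g'"
    using p by (simp add: convex_chart_def C1_diffeomorphism_def)
  then show ?thesis using assms(5) by (rule calm_up_eq_asym_modulus)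
qed

end
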